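(* Consider a uniform polar mesh with radial step $\Delta r>0$ and angular step $\Delta\theta>0$, with face radii $r_{i+1/2}>0$, cell mean radii $r_i>0$ and angles $\theta_j,\theta_{j+1/2}$, and let $B_z\neq 0$ be a constant. Let $\Phi_{i+1/2,j+1/2}\in\mathbb{R}$ be arbitrary values (of the electric potential) given at the mesh nodes $(r_{i+1/2},\theta_{j+1/2})$, whatever the way they are computed. Define the discrete velocity field at the centers of the cell faces, for all $i,j$, by $$a_r(r_{i+1/2},\theta_j)=\frac{-1}{r_{i+1/2}\,B_z}\,\frac{\Phi_{i+1/2,j+1/2}-\Phi_{i+1/2,j-1/2}}{\Delta\theta},$$ $$a_\theta(r_i,\theta_{j+1/2})=\frac{1}{r_i\,B_z}\,\frac{\Phi_{i+1/2,j+1/2}-\Phi_{i-1/2,j+1/2}}{\Delta r}.$$ Then the discrete polar divergence of this velocity field vanishes in every cell $(i,j)$: $$\frac{1}{r_i}\,\frac{r_{i+1/2}\,a_r(r_{i+1/2},\theta_j)-r_{i-1/2}\,a_r(r_{i-1/2},\theta_j)}{\Delta r}+\frac{1}{r_i}\,\frac{r_i\,a_\theta(r_i,\theta_{j+1/2})-r_i\,a_\theta(r_i,\theta_{j-1/2})}{\Delta\theta}=0.$$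
   Context: Polar mesh: cell $(i,j)$ is $[r_{i-1/2},r_{i+1/2}]\times[\theta_{j-1/2},\theta_{j+1/2}]$ with constant steps $\Delta r=r_{i+1/2}-r_{i-1/2}$ and $\Delta\theta=\theta_{j+1/2}-\theta_{j-1/2}$. Here $r_i$ is the mean radius of the cell, $(r_i,\theta_j)$ is the cell center, the points $(r_{i\pm1/2},\theta_{j\pm1/2})$ are the mesh nodes, and $(r_{i\pm1/2},\theta_j)$ and $(r_i,\theta_{j\pm1/2})$ are the centers of the cell faces. The index $i$ ranges over the radial cells and $j$ over the angular cells. The velocity formulas are used at all faces, so that $a_r(r_{i-1/2},\theta_j)$ and $a_\theta(r_i,\theta_{j-1/2})$ are obtained by shifting $i$ or $j$ by one. The constant $B_z$ is the magnitude of the constant magnetic field $B=B_z e_z$. The discrete velocity field is a finite difference approximation of the continuous field $a_r=\frac{-1}{rB_z}\partial_\theta\Phi$, $a_\theta=\frac{1}{rB_z}\partial_r\Phi$, and the discrete divergence approximates $\frac1r\partial_r(r a_r)+\frac1r\partial_\theta(r a_\theta)$. *)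

theory Defs
  imports Complex_Main
begin

text \<open>
  Half-integer indices are shifted by one half: an integer index \<open>i\<close> at a face or node stands
  for \<open>i + 1/2\<close>.  Thus \<open>face_radius M i\<close> is \<open>r\<^sub>i\<^sub>+\<^sub>1\<^sub>/\<^sub>2\<close>, \<open>face_radius M (i - 1)\<close>
  is \<open>r\<^sub>i\<^sub>-\<^sub>1\<^sub>/\<^sub>2\<close>, and likewise for the angles.  The cells are \<open>(i, j)\<close> with
  \<open>1 \<le> i \<le> radial_cells M\<close> and \<open>1 \<le> j \<le> angular_cells M\<close>, so faces and nodes
  have indices starting from 0.  The range is bounded because face radii in arithmetic
  progression cannot be positive for all integer indices.
\<close>

record polar_mesh =
  radial_cells :: int
  angular_cells :: int
  radial_step :: real
  angular_step :: real
  face_radius :: "int \<Rightarrow> real"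
  face_angle :: "int \<Rightarrow> real"

definition uniform_polar_mesh :: "polar_mesh \<Rightarrow> bool" where
  "uniform_polar_mesh M \<longleftrightarrow>
     radial_step M > 0 \<and> angular_step M > 0 \<and>
     (\<forall>i\<in>{0..radial_cells M}. face_radius M i > 0) \<and>
     (\<forall>i\<in>{1..radial_cells M}. face_radius M i - face_radius M (i - 1) = radial_step M) \<and>
     (\<forall>j\<in>{1..angular_cells M}. face_angle M j - face_angle M (j - 1) = angular_step M)"

definition cell_radius :: "polar_mesh \<Rightarrow> int \<Rightarrow> real" where
  "cell_radius M i = (face_radius M (i - 1) + face_radius M i) / 2"

text \<open>
  A potential \<open>\<Phi>\<close> is a family of node values: \<open>\<Phi> i j\<close> is the value at the node
  \<open>(r\<^sub>i\<^sub>+\<^sub>1\<^sub>/\<^sub>2, \<theta>\<^sub>j\<^sub>+\<^sub>1\<^sub>/\<^sub>2)\<close>.  The velocity components live at face centers: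
  \<open>radial_velocity M Bz \<Phi> i j\<close> is \<open>a\<^sub>r(r\<^sub>i\<^sub>+\<^sub>1\<^sub>/\<^sub>2, \<theta>\<^sub>j)\<close> and
  \<open>angular_velocity M Bz \<Phi> i j\<close> is \<open>a\<^sub>\<theta>(r\<^sub>i, \<theta>\<^sub>j\<^sub>+\<^sub>1\<^sub>/\<^sub>2)\<close>.
\<close>

definition radial_velocity ::
    "polar_mesh \<Rightarrow> real \<Rightarrow> (int \<Rightarrow> int \<Rightarrow> real) \<Rightarrow> int \<Rightarrow> int \<Rightarrow> real" where
  "radial_velocity M Bz \<Phi> i j =
     (-1) / (face_radius M i * Bz) * ((\<Phi> i j - \<Phi> i (j - 1)) / angular_step M)"

definition angular_velocity ::
    "polar_mesh \<Rightarrow> real \<Rightarrow> (int \<Rightarrow> int \<Rightarrow> real) \<Rightarrow> int \<Rightarrow> int \<Rightarrow> real" where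
  "angular_velocity M Bz \<Phi> i j =
     1 / (cell_radius M i * Bz) * ((\<Phi> i j - \<Phi> (i - 1) j) / radial_step M)"

text \<open>
  The arguments \<open>a\<^sub>r\<close> and \<open>a\<^sub>\<theta>\<close> are arbitrary families of face-center values, indexed as above.
\<close>

definition polar_divergence ::
    "polar_mesh \<Rightarrow> (int \<Rightarrow> int \<Rightarrow> real) \<Rightarrow> (int \<Rightarrow> int \<Rightarrow> real) \<Rightarrow> int \<Rightarrow> int \<Rightarrow> real" where
  "polar_divergence M a\<^sub>r a\<^sub>\<theta> i j =
     1 / cell_radius M i *
       ((face_radius M i * a\<^sub>r i j - face_radius M (i - 1) * a\<^sub>r (i - 1) j) / radial_step M) +
     1 / cell_radius M i *
       ((cell_radius M i * a\<^sub>\<theta> i j - cell_radius M i * a\<^sub>\<theta> i (j - 1)) / angular_step M)"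

end

theory Submission
  imports Defs
begin

text \<open>
  Multiplying the velocities by the radius cancels the radius in their denominators.  What remains
  are the two mixed second differences of the potential over the four nodes of the cell, with
  opposite signs, and these coincide.
\<close>

lemma face_radius_times_radial_velocity:
  assumes "face_radius M i \<noteq> 0"
  shows "face_radius M i * radial_velocity M Bz \<Phi> i j =
           - ((\<Phi> i j - \<Phi> i (j - 1)) / (Bz * angular_step M))"
  using assms by (simp add: radial_velocity_def)

lemma cell_radius_times_angular_velocity:
  assumes "cell_radius M i \<noteq> 0"
  shows "cell_radius M i * angular_velocity M Bz \<Phi> i j =
           (\<Phi> i j - \<Phi> (i - 1) j) / (Bz * radial_step M)"
  using assms by (simp add: angular_velocity_def)

lemma polar_divergence_eq_0:
  assumes "face_radius M i \<noteq> 0" "face_radius M (i - 1) \<noteq> 0" "cell_radius M i \<noteq> 0"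
  shows "polar_divergence M (radial_velocity M Bz \<Phi>) (angular_velocity M Bz \<Phi>) i j = 0"
  unfolding polar_divergence_def
    face_radius_times_radial_velocity[OF assms(1)]
    face_radius_times_radial_velocity[OF assms(2)]
    cell_radius_times_angular_velocity[OF assms(3)]
  \<comment> \<open>Once the quotients are split, each of the four node values occurs twice over the
    same product of \<open>cell_radius M i\<close>, \<open>Bz\<close> and both steps, with opposite
    signs.\<close>
  by (simp add: diff_divide_distrib add_divide_distrib algebra_simps)

theorem proposition1:
  fixes M :: polar_mesh
    and Bz :: real
    and \<Phi> :: "int \<Rightarrow> int \<Rightarrow> real"
  assumes "uniform_polar_mesh M"
    and "Bz \<noteq> 0"
  shows "\<forall>i\<in>{1..radial_cells M}. \<forall>j\<in>{1..angular_cells M}.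
           polar_divergence M (radial_velocity M Bz \<Phi>) (angular_velocity M Bz \<Phi>) i j = 0"
proof (intro ballI)
  fix i j
  assume "i \<in> {1..radial_cells M}"
  \<comment> \<open>Face indices start at 0, so the inner face of the first cell is covered
    too.\<close>
  then have "face_radius M i > 0" "face_radius M (i - 1) > 0"
    using assms(1) by (auto simp: uniform_polar_mesh_def)
  then show "polar_divergence M (radial_velocity M Bz \<Phi>) (angular_velocity M Bz \<Phi>) i j = 0"
    \<comment> \<open>The cell radius is the mean of two positive face radii, hence nonzero.\<close>
    by (intro polar_divergence_eq_0) (auto simp: cell_radius_def)
qed

end
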